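(* Let $X$ be a locally convex Hausdorff topological vector space and let $f_1,f_2:X\to\overline{\mathbb{R}}$ be two proper functions. If $f_1$ is polyhedral convex and $f_2$ is generalized polyhedral convex, then the infimal convolution $f_1\square f_2$ is a polyhedral convex function.
   Context: $X$ is a real locally convex Hausdorff topological vector space and $\overline{\mathbb{R}}=\mathbb{R}\cup\{\pm\infty\}$. In a locally convex Hausdorff topological vector space $Z$ with dual $Z^*$, a subset $D$ is a generalized polyhedral convex set if $D=\{z\in L\mid \langle z_i^*,z\rangle\le\alpha_i,\ i=1,\dots,p\}$ for some $z_i^*\in Z^*$, $\alpha_i\in\mathbb{R}$ and some closed affine subspace $L\subset Z$; it is a polyhedral convex set if one can take $L=Z$. For $f:X\to\overline{\mathbb{R}}$: $\mathrm{dom} f=\{x\in X\mid f(x)<+\infty\}$, $\mathrm{epi} f=\{(x,\alpha)\in X\times\mathbb{R}\mid x\in\mathrm{dom} f,\ f(x)\le\alpha\}$; $f$ is proper if $\mathrm{dom} f\ne\emptyset$ and $f(x)>-\infty$ for all $x\in X$. A function $f:X\to\overline{\mathbb{R}}$ (not necessarily proper) is generalized polyhedral convex (resp., polyhedral convex) if $\mathrm{epi} f$ is a generalized polyhedral convex set (resp., a polyhedral convex set) in $X\times\mathbb{R}$. The infimal convolution of proper functions $f_1,f_2$ is $(f_1\square f_2)(x)=\inf\{f_1(x_1)+f_2(x_2)\mid x_1,x_2\in X,\ x_1+x_2=x\}$; it may take the values $\pm\infty$. *)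

theory Defs
  imports "HOL-Analysis.Analysis"
begin

text \<open>The condition on \<open>u, v\<close> below is \<open>convex V\<close> written out (\<^const>\<open>convex\<close> itself is not
  available inside a class specification); see \<open>locally_convex\<close>.\<close>

class lc_hausdorff_tvs = real_vector + topological_ab_group_add + t2_space +
  assumes tendsto_scaleR_nhds:
      "\<And>c x. ((\<lambda>z. fst z *\<^sub>R snd z) \<longlongrightarrow> c *\<^sub>R x) (nhds c \<times>\<^sub>F nhds x)"
    and locally_convex_raw:
      "\<And>U. open U \<Longrightarrow> 0 \<in> U \<Longrightarrow> \<exists>V. open V \<and>
         (\<forall>x\<in>V. \<forall>y\<in>V. \<forall>u\<ge>0. \<forall>v\<ge>0. u + v = 1 \<longrightarrow> u *\<^sub>R x + v *\<^sub>R y \<in> V) \<and>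
         0 \<in> V \<and> V \<subseteq> U"

lemma locally_convex:
  fixes U :: "'a::lc_hausdorff_tvs set"
  assumes "open U" "0 \<in> U"
  shows "\<exists>V. open V \<and> convex V \<and> 0 \<in> V \<and> V \<subseteq> U"
  using locally_convex_raw[OF assms] unfolding convex_def .

instance real_normed_vector \<subseteq> lc_hausdorff_tvs
proof
  fix c :: real and x :: 'a
  show "((\<lambda>z. fst z *\<^sub>R snd z) \<longlongrightarrow> c *\<^sub>R x) (nhds c \<times>\<^sub>F nhds x)"
    by (intro tendsto_scaleR filterlim_fst filterlim_snd)
next
  fix U :: "'a set"
  assume "open U" "0 \<in> U"
  then obtain e where "e > 0" "ball 0 e \<subseteq> U"
    using open_contains_ball by blast
  then show "\<exists>V. open V \<and>
         (\<forall>x\<in>V. \<forall>y\<in>V. \<forall>u\<ge>0. \<forall>v\<ge>0. u + v = 1 \<longrightarrow> u *\<^sub>R x + v *\<^sub>R y \<in> V) \<and>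
         0 \<in> V \<and> V \<subseteq> U"
    unfolding convex_def[symmetric]
    by (intro exI[of _ "ball 0 e"]) auto
qed

text \<open>The product topology makes \<open>X \<times> Y\<close> (in particular \<open>X \<times> \<real>\<close>) such a space again. The library
  provides the arities of the topological additive classes only for products of normed spaces.\<close>

instance prod :: (topological_monoid_add, topological_monoid_add) topological_monoid_add
proof
  fix a b :: "'a \<times> 'b"
  let ?F = "nhds a \<times>\<^sub>F nhds b"
  have p: "(fst \<longlongrightarrow> a) ?F" and q: "(snd \<longlongrightarrow> b) ?F"
    by (rule filterlim_fst filterlim_snd)+
  have "((\<lambda>x. (fst (fst x) + fst (snd x), snd (fst x) + snd (snd x))) \<longlongrightarrow>
      (fst a + fst b, snd a + snd b)) ?F"
    by (intro tendsto_Pair tendsto_add tendsto_fst tendsto_snd p q)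
  then show "((\<lambda>x. fst x + snd x) \<longlongrightarrow> a + b) ?F"
    by (simp add: plus_prod_def)
qed

instance prod :: (topological_comm_monoid_add, topological_comm_monoid_add)
  topological_comm_monoid_add ..

instance prod :: (topological_group_add, topological_group_add) topological_group_add
proof
  fix a :: "'a \<times> 'b"
  have p: "((\<lambda>x. x) \<longlongrightarrow> a) (nhds a)"
    by (rule filterlim_ident)
  have "((\<lambda>x. (- fst x, - snd x)) \<longlongrightarrow> (- fst a, - snd a)) (nhds a)"
    by (intro tendsto_Pair tendsto_minus tendsto_fst tendsto_snd p)
  then show "(uminus \<longlongrightarrow> - a) (nhds a)"
    by (simp add: uminus_prod_def[abs_def])
qed

instance prod :: (topological_ab_group_add, topological_ab_group_add) topological_ab_group_add ..

instance prod :: (lc_hausdorff_tvs, lc_hausdorff_tvs) lc_hausdorff_tvs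
proof
  fix c :: real and x :: "'a \<times> 'b"
  have fs: "filterlim fst (nhds c) (nhds c \<times>\<^sub>F nhds x)"
    and sn: "((\<lambda>z. snd z) \<longlongrightarrow> x) (nhds c \<times>\<^sub>F nhds x)"
    by (rule filterlim_fst filterlim_snd)+
  have A: "((\<lambda>z. fst z *\<^sub>R fst (snd z)) \<longlongrightarrow> c *\<^sub>R fst x) (nhds c \<times>\<^sub>F nhds x)"
    using filterlim_compose[OF tendsto_scaleR_nhds filterlim_Pair[OF fs tendsto_fst[OF sn]]]
    by simp
  have B: "((\<lambda>z. fst z *\<^sub>R snd (snd z)) \<longlongrightarrow> c *\<^sub>R snd x) (nhds c \<times>\<^sub>F nhds x)"
    using filterlim_compose[OF tendsto_scaleR_nhds filterlim_Pair[OF fs tendsto_snd[OF sn]]]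
    by simp
  show "((\<lambda>z. fst z *\<^sub>R snd z) \<longlongrightarrow> c *\<^sub>R x) (nhds c \<times>\<^sub>F nhds x)"
    using tendsto_Pair[OF A B] by (simp add: scaleR_prod_def)
next
  fix U :: "('a \<times> 'b) set"
  assume "open U" "0 \<in> U"
  then obtain A B where AB: "open A" "open B" "0 \<in> A \<times> B" "A \<times> B \<subseteq> U"
    by (rule open_prod_elim)
  have "0 \<in> A" "0 \<in> B"
    using AB(3) by (auto simp: zero_prod_def)
  obtain V where V: "open V" "convex V" "0 \<in> V" "V \<subseteq> A"
    using locally_convex[OF AB(1) \<open>0 \<in> A\<close>] by blast
  obtain W where W: "open W" "convex W" "0 \<in> W" "W \<subseteq> B"
    using locally_convex[OF AB(2) \<open>0 \<in> B\<close>] by blast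
  have "open (V \<times> W) \<and> convex (V \<times> W) \<and> 0 \<in> V \<times> W \<and> V \<times> W \<subseteq> U"
    using V W AB(4) by (auto simp: zero_prod_def intro: open_Times convex_Times)
  then show "\<exists>V. open V \<and>
         (\<forall>x\<in>V. \<forall>y\<in>V. \<forall>u\<ge>0. \<forall>v\<ge>0. u + v = 1 \<longrightarrow> u *\<^sub>R x + v *\<^sub>R y \<in> V) \<and>
         0 \<in> V \<and> V \<subseteq> U"
    unfolding convex_def[symmetric] ..
qed

definition dual_space :: "('a::lc_hausdorff_tvs \<Rightarrow> real) set" where
  "dual_space = {\<phi>. linear \<phi> \<and> continuous_on UNIV \<phi>}"

text \<open>\<^const>\<open>affine\<close> admits the empty set. This does not enlarge the class of generalized
  polyhedral convex sets, since \<open>{}\<close> is also cut out of the whole space by \<open>0 \<le> -1\<close>.\<close>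

definition generalized_polyhedral_convex_set :: "'a::lc_hausdorff_tvs set \<Rightarrow> bool" where
  "generalized_polyhedral_convex_set D \<longleftrightarrow>
     (\<exists>L (p::nat) z \<alpha>. affine L \<and> closed L \<and> (\<forall>i\<in>{1..p}. z i \<in> dual_space) \<and>
        D = {x \<in> L. \<forall>i\<in>{1..p}. z i x \<le> \<alpha> i})"

definition polyhedral_convex_set :: "'a::lc_hausdorff_tvs set \<Rightarrow> bool" where
  "polyhedral_convex_set D \<longleftrightarrow>
     (\<exists>(p::nat) z \<alpha>. (\<forall>i\<in>{1..p}. z i \<in> dual_space) \<and>
        D = {x. \<forall>i\<in>{1..p}. z i x \<le> \<alpha> i})"

definition effective_domain :: "('a \<Rightarrow> ereal) \<Rightarrow> 'a set" where
  "effective_domain f = {x. f x < \<infinity>}"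

definition epi :: "('a \<Rightarrow> ereal) \<Rightarrow> ('a \<times> real) set" where
  "epi f = {(x, \<alpha>). x \<in> effective_domain f \<and> f x \<le> ereal \<alpha>}"

definition proper_function :: "('a \<Rightarrow> ereal) \<Rightarrow> bool" where
  "proper_function f \<longleftrightarrow> effective_domain f \<noteq> {} \<and> (\<forall>x. f x > -\<infinity>)"

definition generalized_polyhedral_convex_function ::
    "('a::lc_hausdorff_tvs \<Rightarrow> ereal) \<Rightarrow> bool" where
  "generalized_polyhedral_convex_function f \<longleftrightarrow> generalized_polyhedral_convex_set (epi f)"

definition polyhedral_convex_function :: "('a::lc_hausdorff_tvs \<Rightarrow> ereal) \<Rightarrow> bool" where
  "polyhedral_convex_function f \<longleftrightarrow> polyhedral_convex_set (epi f)"

text \<open>Intended for proper arguments, for which \<open>\<infinity> + -\<infinity>\<close> does not occur. The infimum is taken in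
  the complete lattice \<^typ>\<open>ereal\<close>, so the value may be \<open>\<plusminus>\<infinity>\<close>.\<close>

definition infimal_convolution ::
    "('a::plus \<Rightarrow> ereal) \<Rightarrow> ('a \<Rightarrow> ereal) \<Rightarrow> 'a \<Rightarrow> ereal" (infixl \<open>\<box>\<close> 65) where
  "(f\<^sub>1 \<box> f\<^sub>2) x = Inf {f\<^sub>1 x\<^sub>1 + f\<^sub>2 x\<^sub>2 | x\<^sub>1 x\<^sub>2. x\<^sub>1 + x\<^sub>2 = x}"

end

theory Submission
  imports Defs
begin

text \<open>The epigraph of \<open>f\<^sub>1 \<box> f\<^sub>2\<close> is the sum of the two epigraphs, up to closure in the vertical
  direction; hence it suffices that \<open>P + D\<close> is polyhedral, and so vertically closed, whenever \<open>P\<close> is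
  polyhedral and \<open>D\<close> is generalized polyhedral. Let \<open>D\<close> be cut out of \<open>a + M\<close>, with \<open>M\<close> a linear
  subspace, by the inequalities of a polyhedral set \<open>Q\<close>. Then \<open>R = {(z, y). z - y \<in> P \<and> y \<in> Q}\<close> is
  polyhedral and \<open>P + D\<close> is the slice at \<open>a\<close> of \<open>R + {0} \<times> M\<close>. Finally, a polyhedral set plus a
  subspace is polyhedral: modulo the common kernel of the defining functionals the subspace is
  finite-dimensional, and a line can be added by Fourier--Motzkin elimination.\<close>

section \<open>Polyhedral sets as finite systems of inequalities\<close>

lemma polyhedral_convex_set_finite:
  "polyhedral_convex_set D \<longleftrightarrow>
     (\<exists>C. finite C \<and> fst ` C \<subseteq> dual_space \<and> D = {x. \<forall>c\<in>C. fst c x \<le> snd c})"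
proof
  assume "polyhedral_convex_set D"
  then obtain p :: nat and z \<alpha> where "\<forall>i\<in>{1..p}. z i \<in> dual_space"
    "D = {x. \<forall>i\<in>{1..p}. z i x \<le> \<alpha> i}"
    unfolding polyhedral_convex_set_def by blast
  then show "\<exists>C. finite C \<and> fst ` C \<subseteq> dual_space \<and> D = {x. \<forall>c\<in>C. fst c x \<le> snd c}"
    by (intro exI[of _ "(\<lambda>i. (z i, \<alpha> i)) ` {1..p}"]) auto
next
  assume "\<exists>C. finite C \<and> fst ` C \<subseteq> dual_space \<and> D = {x. \<forall>c\<in>C. fst c x \<le> snd c}"
  then obtain C where C: "finite C" "fst ` C \<subseteq> dual_space" "D = {x. \<forall>c\<in>C. fst c x \<le> snd c}"
    by blast
  obtain h where "bij_betw h {1..card C} C"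
    using ex_bij_betw_nat_finite_1[OF C(1)] by blast
  then have h: "C = h ` {1..card C}"
    by (simp add: bij_betw_def)
  have "\<forall>i\<in>{1..card C}. fst (h i) \<in> dual_space"
    using C(2) h by blast
  moreover have "D = {x. \<forall>i\<in>{1..card C}. fst (h i) x \<le> snd (h i)}"
    unfolding C(3) by (subst h) simp
  ultimately show "polyhedral_convex_set D"
    unfolding polyhedral_convex_set_def
    by (intro exI[of _ "card C"] exI[of _ "\<lambda>i. fst (h i)"] exI[of _ "\<lambda>i. snd (h i)"] conjI)
qed

lemma dual_space_linear: "\<phi> \<in> dual_space \<Longrightarrow> linear \<phi>"
  by (simp add: dual_space_def)

lemma dual_space_scale: "\<phi> \<in> dual_space \<Longrightarrow> (\<lambda>x. \<phi> x / r) \<in> dual_space"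
  unfolding dual_space_def
  by (auto simp: linear_iff divide_inverse distrib_right intro!: continuous_intros)

lemma dual_space_diff:
  "\<phi> \<in> dual_space \<Longrightarrow> \<psi> \<in> dual_space \<Longrightarrow> (\<lambda>x. \<phi> x - \<psi> x) \<in> dual_space"
  unfolding dual_space_def by (auto intro: linear_compose_sub continuous_on_diff)

lemma dual_space_compose:
  assumes "linear T" "continuous_on UNIV T" "\<phi> \<in> dual_space"
  shows "(\<lambda>x. \<phi> (T x)) \<in> dual_space"
  using assms linear_compose[of T \<phi>] continuous_on_compose2[of UNIV \<phi> UNIV T]
  by (simp add: dual_space_def o_def)

lemma polyhedral_convex_set_empty: "polyhedral_convex_set ({} :: 'a::lc_hausdorff_tvs set)"
  unfolding polyhedral_convex_set_finite
  by (rule exI[of _ "{(\<lambda>_. 0, -1)}"]) (auto simp: dual_space_def linear_iff)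

lemma polyhedral_convex_set_Int:
  assumes "polyhedral_convex_set A" "polyhedral_convex_set B"
  shows "polyhedral_convex_set (A \<inter> B)"
proof -
  obtain C where "finite C" "fst ` C \<subseteq> dual_space" "A = {x. \<forall>c\<in>C. fst c x \<le> snd c}"
    using assms(1) unfolding polyhedral_convex_set_finite by blast
  moreover obtain C' where "finite C'" "fst ` C' \<subseteq> dual_space" "B = {x. \<forall>c\<in>C'. fst c x \<le> snd c}"
    using assms(2) unfolding polyhedral_convex_set_finite by blast
  ultimately show ?thesis
    unfolding polyhedral_convex_set_finite by (intro exI[of _ "C \<union> C'"]) auto
qed

text \<open>Composing a functional with \<open>T\<close> stays in the dual, and by linearity its
  value at \<open>b\<close> can be moved into the bound.\<close>

lemma polyhedral_convex_set_affine_vimage: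
  assumes "polyhedral_convex_set A" "linear T" "continuous_on UNIV T"
  shows "polyhedral_convex_set {x. T x + b \<in> A}"
proof -
  obtain C where C: "finite C" "fst ` C \<subseteq> dual_space" "A = {x. \<forall>c\<in>C. fst c x \<le> snd c}"
    using assms(1) unfolding polyhedral_convex_set_finite by blast
  have *: "fst c (T x + b) \<le> snd c \<longleftrightarrow> fst c (T x) \<le> snd c - fst c b" if "c \<in> C" for c x
  proof -
    have "linear (fst c)"
      using C(2) that by (auto intro: dual_space_linear)
    then show ?thesis
      by (simp add: linear_add le_diff_eq)
  qed
  have "{x. T x + b \<in> A} =
      {x. \<forall>c\<in>(\<lambda>c. (\<lambda>x. fst c (T x), snd c - fst c b)) ` C. fst c x \<le> snd c}"
    by (simp add: C(3) * cong: ball_cong)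
  moreover have "fst ` (\<lambda>c. (\<lambda>x. fst c (T x), snd c - fst c b)) ` C \<subseteq> dual_space"
    using dual_space_compose[OF assms(2,3)] C(2) by (simp add: image_subset_iff)
  ultimately show ?thesis
    unfolding polyhedral_convex_set_finite using C(1) by blast
qed

section \<open>Elimination of one variable\<close>

lemma finite_separation:
  fixes A B :: "real set"
  assumes "finite A" "finite B" "\<And>a b. a \<in> A \<Longrightarrow> b \<in> B \<Longrightarrow> a \<le> b"
  shows "\<exists>t. (\<forall>a\<in>A. a \<le> t) \<and> (\<forall>b\<in>B. t \<le> b)"
proof (cases "A = {}")
  case True
  then show ?thesis
    using assms(2) by (cases "B = {}") (auto intro!: exI[of _ "Min B"])
next
  case False
  then show ?thesis
    using assms by (intro exI[of _ "Max A"]) auto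
qed

text \<open>Along direction \<open>y\<close> each constraint is a condition on the real parameter
  \<open>t\<close>: void, an upper bound or a lower bound, according to the sign of its functional
  at \<open>y\<close>. A common \<open>t\<close> exists iff every lower bound is at most every upper
  bound, and these pairwise comparisons are again linear inequalities in \<open>z\<close>.\<close>

lemma polyhedral_convex_set_plus_line:
  assumes "polyhedral_convex_set P"
  shows "polyhedral_convex_set {z. \<exists>t. z + t *\<^sub>R y \<in> P}"
proof -
  obtain C where C: "finite C" "fst ` C \<subseteq> dual_space" "P = {x. \<forall>c\<in>C. fst c x \<le> snd c}"
    using assms unfolding polyhedral_convex_set_finite by blast
  define Z where "Z = {c\<in>C. fst c y = 0}"
  define U where "U = {c\<in>C. fst c y > 0}"
  define L where "L = {c\<in>C. fst c y < 0}"
  \<comment> \<open>This is \<open>bound l z \<le> bound u z\<close>, with the terms in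
    \<open>z\<close> collected on one side and the constants on the other.\<close>
  define comb where "comb = (\<lambda>(u, l). (\<lambda>x. fst u x / fst u y - fst l x / fst l y,
      snd u / fst u y - snd l / fst l y :: real))"
  let ?C' = "Z \<union> comb ` (U \<times> L)"
  have CZUL: "C = Z \<union> U \<union> L"
    by (auto simp: Z_def U_def L_def)
  have line: "fst c (z + t *\<^sub>R y) = fst c z + t * fst c y" if "c \<in> C" for c z t
  proof -
    have "linear (fst c)"
      using C(2) that by (auto intro: dual_space_linear)
    then show ?thesis
      by (simp add: linear_add linear_scale)
  qed
  define bound where "bound c z = (snd c - fst c z) / fst c y" for c :: "('a \<Rightarrow> real) \<times> real" and z
  have Z: "fst c (z + t *\<^sub>R y) \<le> snd c \<longleftrightarrow> fst c z \<le> snd c" if "c \<in> Z" for c z t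
    using that line[of c] by (simp add: Z_def)
  have U: "fst c (z + t *\<^sub>R y) \<le> snd c \<longleftrightarrow> t \<le> bound c z" if "c \<in> U" for c z t
    using that line[of c] by (simp add: U_def bound_def pos_le_divide_eq algebra_simps)
  have L: "fst c (z + t *\<^sub>R y) \<le> snd c \<longleftrightarrow> bound c z \<le> t" if "c \<in> L" for c z t
    using that line[of c] by (simp add: L_def bound_def neg_divide_le_eq algebra_simps)
  have comb: "fst (comb (u, l)) z \<le> snd (comb (u, l)) \<longleftrightarrow> bound l z \<le> bound u z" for u l z
    by (auto simp: comb_def bound_def diff_divide_distrib)
  have "(\<exists>t. z + t *\<^sub>R y \<in> P) \<longleftrightarrow> (\<forall>c\<in>?C'. fst c z \<le> snd c)" for z
  proof -
    have "(\<exists>t. z + t *\<^sub>R y \<in> P) \<longleftrightarrow> (\<forall>c\<in>Z. fst c z \<le> snd c) \<and>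
        (\<exists>t. (\<forall>l\<in>L. bound l z \<le> t) \<and> (\<forall>u\<in>U. t \<le> bound u z))"
      by (auto simp: C(3) CZUL ball_Un Z U L)
    also have "(\<exists>t. (\<forall>l\<in>L. bound l z \<le> t) \<and> (\<forall>u\<in>U. t \<le> bound u z)) \<longleftrightarrow>
        (\<forall>u\<in>U. \<forall>l\<in>L. bound l z \<le> bound u z)"
    proof
      assume "\<forall>u\<in>U. \<forall>l\<in>L. bound l z \<le> bound u z"
      moreover have "finite U" "finite L"
        using C(1) by (auto simp: U_def L_def)
      ultimately show "\<exists>t. (\<forall>l\<in>L. bound l z \<le> t) \<and> (\<forall>u\<in>U. t \<le> bound u z)"
        using finite_separation[of "(\<lambda>l. bound l z) ` L" "(\<lambda>u. bound u z) ` U"] by auto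
    qed (meson order_trans)
    also have "(\<forall>c\<in>Z. fst c z \<le> snd c) \<and> (\<forall>u\<in>U. \<forall>l\<in>L. bound l z \<le> bound u z) \<longleftrightarrow>
        (\<forall>c\<in>?C'. fst c z \<le> snd c)"
      by (auto simp: ball_Un comb)
    finally show ?thesis .
  qed
  moreover have "finite ?C'"
    using C(1) by (auto simp: Z_def U_def L_def)
  moreover have "fst c \<in> dual_space" if "c \<in> C" for c
    using C(2) that by blast
  then have "fst ` ?C' \<subseteq> dual_space"
    by (force simp: Z_def U_def L_def comb_def intro!: dual_space_diff dual_space_scale)
  ultimately show ?thesis
    unfolding polyhedral_convex_set_finite by (intro exI[of _ ?C']) auto
qed

section \<open>Adding a linear subspace\<close>

lemma polyhedral_convex_set_plus_span:
  assumes "finite B" "polyhedral_convex_set P"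
  shows "polyhedral_convex_set {z. \<exists>b\<in>span B. z + b \<in> P}"
  using assms
proof (induction B arbitrary: P rule: finite_induct)
  case empty
  then show ?case by simp
next
  case (insert y B)
  have "{z. \<exists>b\<in>span (insert y B). z + b \<in> P} = {z. \<exists>b\<in>span B. z + b \<in> {z. \<exists>t. z + t *\<^sub>R y \<in> P}}"
    (is "?l = ?r")
  proof (intro set_eqI iffI)
    fix z assume "z \<in> ?l"
    then obtain b k where "z + b \<in> P" "b - k *\<^sub>R y \<in> span B"
      by (auto simp: span_insert)
    then show "z \<in> ?r"
      by (auto intro!: bexI[of _ "b - k *\<^sub>R y"] exI[of _ k])
  next
    fix z assume "z \<in> ?r"
    then obtain b t where "b \<in> span B" "z + b + t *\<^sub>R y \<in> P"
      by auto
    then show "z \<in> ?l"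
      by (auto simp: span_insert add.assoc intro!: exI[of _ "b + t *\<^sub>R y"] exI[of _ t])
  qed
  then show ?case
    using insert.IH[OF polyhedral_convex_set_plus_line[OF insert.prems]] by simp
qed

text \<open>\<open>M\<close> is finite-dimensional modulo the common kernel of \<open>F\<close>. For
  each new functional, either some \<open>e\<close> in \<open>M\<close> is invisible to the earlier
  functionals but not to the new one, and \<open>e\<close> joins \<open>B\<close>; or the new
  functional is determined on \<open>M\<close> by the earlier ones, and \<open>B\<close> still
  suffices.\<close>

lemma subspace_finite_span_mod_kernel:
  fixes M :: "'a::real_vector set" and F :: "('a \<Rightarrow> real) set"
  assumes "finite F" "\<And>\<phi>. \<phi> \<in> F \<Longrightarrow> linear \<phi>" "subspace M"
  shows "\<exists>B. finite B \<and> B \<subseteq> M \<and> (\<forall>m\<in>M. \<exists>b\<in>span B. \<forall>\<phi>\<in>F. \<phi> m = \<phi> b)"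
  using assms(1,2)
proof (induction F rule: finite_induct)
  case empty
  then show ?case
    by (intro exI[of _ "{}"]) auto
next
  case (insert \<psi> F)
  then obtain B where B: "finite B" "B \<subseteq> M" "\<And>m. m \<in> M \<Longrightarrow> \<exists>b\<in>span B. \<forall>\<phi>\<in>F. \<phi> m = \<phi> b"
    by auto
  have lin: "linear \<phi>" if "\<phi> \<in> insert \<psi> F" for \<phi>
    using insert.prems that .
  show ?case
  proof (cases "\<exists>e\<in>M. (\<forall>\<phi>\<in>F. \<phi> e = 0) \<and> \<psi> e \<noteq> 0")
    case True
    then obtain e where e: "e \<in> M" "\<And>\<phi>. \<phi> \<in> F \<Longrightarrow> \<phi> e = 0" "\<psi> e \<noteq> 0"
      by blast
    have "\<exists>b\<in>span (insert e B). \<forall>\<phi>\<in>insert \<psi> F. \<phi> m = \<phi> b" if m: "m \<in> M" for m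
    proof -
      obtain b where b: "b \<in> span B" "\<forall>\<phi>\<in>F. \<phi> m = \<phi> b"
        using B(3)[OF m] by blast
      \<comment> \<open>This coefficient corrects the value of \<open>\<psi>\<close>; the
        functionals in \<open>F\<close> vanish at \<open>e\<close> and so keep their values.\<close>
      let ?k = "(\<psi> m - \<psi> b) / \<psi> e"
      have "b + ?k *\<^sub>R e \<in> span (insert e B)"
        using b(1) by (auto simp: span_insert intro!: exI[of _ ?k])
      moreover have "\<phi> m = \<phi> (b + ?k *\<^sub>R e)" if "\<phi> \<in> insert \<psi> F" for \<phi>
        using lin[OF that] b(2) e(2,3) that by (auto simp: linear_add linear_scale)
      ultimately show ?thesis
        by blast
    qed
    then show ?thesis
      using B(1,2) e(1) by (intro exI[of _ "insert e B"]) auto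
  next
    case False
    have "\<exists>b\<in>span B. \<forall>\<phi>\<in>insert \<psi> F. \<phi> m = \<phi> b" if m: "m \<in> M" for m
    proof -
      obtain b where b: "b \<in> span B" "\<forall>\<phi>\<in>F. \<phi> m = \<phi> b"
        using B(3)[OF m] by blast
      \<comment> \<open>The difference lies in \<open>M\<close> and is annihilated by
        \<open>F\<close>, so by the case assumption \<open>\<psi>\<close> annihilates it as
        well.\<close>
      have "m - b \<in> M"
        using m b(1) B(2) assms(3) by (meson span_minimal subsetD subspace_diff)
      moreover have diff: "\<phi> (m - b) = \<phi> m - \<phi> b" if "\<phi> \<in> insert \<psi> F" for \<phi>
        using lin[OF that] by (rule linear_diff)
      moreover have "\<phi> (m - b) = 0" if "\<phi> \<in> F" for \<phi>
        using diff[of \<phi>] b(2) that by simp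
      ultimately have "\<psi> (m - b) = 0"
        using False by blast
      then show ?thesis
        using b diff[of \<psi>] by (intro bexI[of _ b]) auto
    qed
    then show ?thesis
      using B(1,2) by blast
  qed
qed

text \<open>Membership in \<open>P\<close> depends only on the values of finitely many functionals,
  so each \<open>m\<close> may be traded for a \<open>b\<close> in a finitely generated span with
  the same values.\<close>

lemma polyhedral_convex_set_plus_subspace:
  assumes "polyhedral_convex_set P" "subspace M"
  shows "polyhedral_convex_set {z. \<exists>m\<in>M. z + m \<in> P}"
proof -
  obtain C where C: "finite C" "fst ` C \<subseteq> dual_space" "P = {x. \<forall>c\<in>C. fst c x \<le> snd c}"
    using assms(1) unfolding polyhedral_convex_set_finite by blast
  have lin: "linear \<phi>" if "\<phi> \<in> fst ` C" for \<phi>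
    using C(2) that by (blast intro: dual_space_linear)
  obtain B where B: "finite B" "B \<subseteq> M" "\<forall>m\<in>M. \<exists>b\<in>span B. \<forall>\<phi>\<in>fst ` C. \<phi> m = \<phi> b"
    using subspace_finite_span_mod_kernel[OF finite_imageI[OF C(1), of fst] lin assms(2)] by auto
  have "(\<exists>m\<in>M. z + m \<in> P) \<longleftrightarrow> (\<exists>b\<in>span B. z + b \<in> P)" for z
  proof
    assume "\<exists>m\<in>M. z + m \<in> P"
    then obtain m where m: "m \<in> M" "z + m \<in> P"
      by blast
    obtain b where b: "b \<in> span B" "\<forall>\<phi>\<in>fst ` C. \<phi> m = \<phi> b"
      using bspec[OF B(3) m(1)] by (elim bexE)
    have "fst c (z + m) = fst c (z + b)" if "c \<in> C" for c
      using b(2) lin[of "fst c"] that by (simp add: linear_add)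
    then have "z + b \<in> P"
      using m(2) by (simp add: C(3))
    then show "\<exists>b\<in>span B. z + b \<in> P"
      using b(1) by blast
  next
    assume "\<exists>b\<in>span B. z + b \<in> P"
    then show "\<exists>m\<in>M. z + m \<in> P"
      using span_minimal[OF B(2) assms(2)] by blast
  qed
  then show ?thesis
    using polyhedral_convex_set_plus_span[OF B(1) assms(1)] by simp
qed

section \<open>Sum of a polyhedral and a generalized polyhedral set\<close>

lemma polyhedral_convex_set_plus_generalized:
  fixes P D :: "'a::lc_hausdorff_tvs set"
  assumes "polyhedral_convex_set P" "generalized_polyhedral_convex_set D"
  shows "polyhedral_convex_set {x + y | x y. x \<in> P \<and> y \<in> D}"
proof (cases "D = {}")
  case True
  then show ?thesis
    by (simp add: polyhedral_convex_set_empty)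
next
  case False
  obtain L and p :: nat and w \<beta> where L: "affine L" and w: "\<forall>i\<in>{1..p}. w i \<in> dual_space"
    and D: "D = {x \<in> L. \<forall>i\<in>{1..p}. w i x \<le> \<beta> i}"
    using assms(2) unfolding generalized_polyhedral_convex_set_def by blast
  define Q where "Q = {x. \<forall>i\<in>{1..p}. w i x \<le> \<beta> i}"
  have Q: "polyhedral_convex_set Q"
    using w unfolding polyhedral_convex_set_def Q_def by blast
  obtain a where a: "a \<in> L"
    using False D by blast
  define M where "M = {y - a | y. y \<in> L}"
  have M: "subspace M"
    unfolding M_def using affine_diffs_subspace_subtract[OF L a]
    by (simp add: image_def Setcompr_eq_image)
  have "subspace ({0 :: 'a} \<times> M)"
    using M by (intro subspace_Times) simp_all
  moreover
  \<comment> \<open>The summand \<open>y\<close> is kept as a second coordinate because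
    \<open>Q\<close> constrains it; only this coordinate is then moved along \<open>M\<close>. The
    \<open>+ 0\<close> fits the shape of \<open>polyhedral_convex_set_affine_vimage\<close>.\<close>
  let ?R = "{zy. fst zy - snd zy + 0 \<in> P} \<inter> {zy. snd zy + 0 \<in> Q}"
  have "polyhedral_convex_set ?R"
    by (intro polyhedral_convex_set_Int polyhedral_convex_set_affine_vimage assms(1) Q
        linear_compose_sub linear_fst linear_snd continuous_on_diff continuous_on_fst
        continuous_on_snd continuous_on_id)
  ultimately have "polyhedral_convex_set {z. \<exists>m\<in>{0 :: 'a} \<times> M. z + m \<in> ?R}"
    by (intro polyhedral_convex_set_plus_subspace)
  moreover have "linear (\<lambda>z :: 'a. (z, 0 :: 'a))"
    by (simp add: linear_iff)
  moreover have "continuous_on UNIV (\<lambda>z :: 'a. (z, 0 :: 'a))"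
    by (intro continuous_on_Pair continuous_on_id continuous_on_const)
  \<comment> \<open>The slice at \<open>a\<close> is the preimage under the affine map sending
    \<open>z\<close> to \<open>(z, a)\<close>.\<close>
  ultimately have "polyhedral_convex_set
      {z. (z, 0) + (0, a) \<in> {z. \<exists>m\<in>{0 :: 'a} \<times> M. z + m \<in> ?R}}"
    by (rule polyhedral_convex_set_affine_vimage)
  also have "{z. (z, 0) + (0, a) \<in> {z. \<exists>m\<in>{0 :: 'a} \<times> M. z + m \<in> ?R}} =
      {x + y | x y. x \<in> P \<and> y \<in> D}"
  proof (intro set_eqI iffI)
    fix z assume "z \<in> {z. (z, 0) + (0, a) \<in> {z. \<exists>m\<in>{0 :: 'a} \<times> M. z + m \<in> ?R}}"
    then obtain m where m: "m \<in> M" "z - (a + m) \<in> P" "a + m \<in> Q"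
      by auto
    then have "a + m \<in> D"
      by (auto simp: M_def D Q_def)
    moreover have "z = (z - (a + m)) + (a + m)"
      by simp
    ultimately show "z \<in> {x + y | x y. x \<in> P \<and> y \<in> D}"
      using m(2) by blast
  next
    fix z assume "z \<in> {x + y | x y. x \<in> P \<and> y \<in> D}"
    then obtain x y where xy: "z = x + y" "x \<in> P" "y \<in> D"
      by blast
    then have "(0, y - a) \<in> {0 :: 'a} \<times> M" "(z, 0) + (0, a) + (0, y - a) \<in> ?R"
      by (auto simp: M_def D Q_def)
    then show "z \<in> {z. (z, 0) + (0, a) \<in> {z. \<exists>m\<in>{0 :: 'a} \<times> M. z + m \<in> ?R}}"
      by blast
  qed
  finally show ?thesis .
qed

section \<open>Epigraphs and the infimal convolution\<close>

lemma polyhedral_convex_set_right_limit: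
  fixes P :: "('a::lc_hausdorff_tvs \<times> real) set"
  assumes "polyhedral_convex_set P" "\<And>e. e > 0 \<Longrightarrow> (x, \<alpha> + e) \<in> P"
  shows "(x, \<alpha>) \<in> P"
proof -
  obtain C where C: "fst ` C \<subseteq> dual_space" "P = {x. \<forall>c\<in>C. fst c x \<le> snd c}"
    using assms(1) unfolding polyhedral_convex_set_finite by blast
  have "fst c (x, \<alpha>) \<le> snd c" if c: "c \<in> C" for c
  proof -
    have "linear (fst c)"
      using C(1) c by (auto intro: dual_space_linear)
    \<comment> \<open>Each functional is affine in the height \<open>e\<close>, so its non-strict
      bound survives the limit as \<open>e\<close> decreases to 0.\<close>
    then have *: "fst c (x, \<alpha> + e) = fst c (x, \<alpha>) + e * fst c (0, 1)" for e
      using linear_add[of "fst c" "(x, \<alpha>)" "e *\<^sub>R (0, 1)"] linear_scale[of "fst c" e "(0, 1)"]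
      by simp
    have "((\<lambda>e. fst c (x, \<alpha>) + e * fst c (0, 1)) \<longlongrightarrow> fst c (x, \<alpha>) + 0 * fst c (0, 1))
        (at_right 0)"
      by (intro tendsto_intros)
    moreover have "eventually (\<lambda>e. fst c (x, \<alpha>) + e * fst c (0, 1) \<le> snd c) (at_right 0)"
      using eventually_at_right_less
    proof eventually_elim
      case (elim e)
      then show ?case
        using assms(2)[of e] c by (simp add: C(2) *[symmetric])
    qed
    ultimately show ?thesis
      using tendsto_upperbound by fastforce
  qed
  then show ?thesis
    by (simp add: C(2))
qed

lemma epi_iff: "(x, \<alpha>) \<in> epi f \<longleftrightarrow> f x \<le> ereal \<alpha>"
  using le_less_trans[of "f x" "ereal \<alpha>" \<infinity>] by (auto simp: epi_def effective_domain_def)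

text \<open>The infimum is not known in advance to be attained, so a point of the epigraph is first
  placed in the sum only after raising its height by any \<open>e > 0\<close>. Polyhedrality of the
  sum then allows \<open>e\<close> to tend to 0.\<close>

lemma epi_infimal_convolution:
  fixes f\<^sub>1 f\<^sub>2 :: "'a::lc_hausdorff_tvs \<Rightarrow> ereal"
  assumes "proper_function f\<^sub>1" "proper_function f\<^sub>2"
    and P: "polyhedral_convex_set {u + v | u v. u \<in> epi f\<^sub>1 \<and> v \<in> epi f\<^sub>2}" (is "polyhedral_convex_set ?S")
  shows "epi (f\<^sub>1 \<box> f\<^sub>2) = ?S"
proof (intro set_eqI iffI)
  fix w assume "w \<in> epi (f\<^sub>1 \<box> f\<^sub>2)"
  then obtain x \<alpha> where w: "w = (x, \<alpha>)" and le: "(f\<^sub>1 \<box> f\<^sub>2) x \<le> ereal \<alpha>"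
    by (metis epi_iff surj_pair)
  have "(x, \<alpha> + e) \<in> ?S" if "e > 0" for e
  proof -
    have "(f\<^sub>1 \<box> f\<^sub>2) x < ereal (\<alpha> + e)"
      using le_less_trans[OF le] that by simp
    then obtain x\<^sub>1 x\<^sub>2 where x: "x\<^sub>1 + x\<^sub>2 = x" "f\<^sub>1 x\<^sub>1 + f\<^sub>2 x\<^sub>2 < ereal (\<alpha> + e)"
      unfolding infimal_convolution_def Inf_less_iff by blast
    have "f\<^sub>1 x\<^sub>1 > -\<infinity>" "f\<^sub>2 x\<^sub>2 > -\<infinity>"
      using assms(1,2) by (auto simp: proper_function_def)
    \<comment> \<open>Neither value is -\<infinity> and the sum is below a real number, so both are
      real. The first point below lies on the graph of \<open>f\<^sub>1\<close>; all the slack goes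
      to the second.\<close>
    then obtain r s where rs: "f\<^sub>1 x\<^sub>1 = ereal r" "f\<^sub>2 x\<^sub>2 = ereal s"
      using x(2) by (cases "f\<^sub>1 x\<^sub>1"; cases "f\<^sub>2 x\<^sub>2") auto
    have "(x\<^sub>1, r) \<in> epi f\<^sub>1" "(x\<^sub>2, \<alpha> + e - r) \<in> epi f\<^sub>2"
      using x(2) rs by (auto simp: epi_iff)
    moreover have "(x, \<alpha> + e) = (x\<^sub>1, r) + (x\<^sub>2, \<alpha> + e - r)"
      using x(1) by simp
    ultimately show ?thesis
      by blast
  qed
  then show "w \<in> ?S"
    unfolding w by (rule polyhedral_convex_set_right_limit[OF P])
next
  fix w assume "w \<in> ?S"
  then obtain x\<^sub>1 \<alpha>\<^sub>1 x\<^sub>2 \<alpha>\<^sub>2 where w: "w = (x\<^sub>1 + x\<^sub>2, \<alpha>\<^sub>1 + \<alpha>\<^sub>2)"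
    and le: "f\<^sub>1 x\<^sub>1 \<le> ereal \<alpha>\<^sub>1" "f\<^sub>2 x\<^sub>2 \<le> ereal \<alpha>\<^sub>2"
    by (auto simp: epi_iff)
  have "(f\<^sub>1 \<box> f\<^sub>2) (x\<^sub>1 + x\<^sub>2) \<le> f\<^sub>1 x\<^sub>1 + f\<^sub>2 x\<^sub>2"
    unfolding infimal_convolution_def by (rule Inf_lower) blast
  also have "\<dots> \<le> ereal (\<alpha>\<^sub>1 + \<alpha>\<^sub>2)"
    using add_mono[OF le] by simp
  finally show "w \<in> epi (f\<^sub>1 \<box> f\<^sub>2)"
    by (simp add: w epi_iff)
qed

theorem proposition3p12:
  fixes f\<^sub>1 f\<^sub>2 :: "'a::lc_hausdorff_tvs \<Rightarrow> ereal"
  assumes "proper_function f\<^sub>1"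
    and "proper_function f\<^sub>2"
    and "polyhedral_convex_function f\<^sub>1"
    and "generalized_polyhedral_convex_function f\<^sub>2"
  shows "polyhedral_convex_function (f\<^sub>1 \<box> f\<^sub>2)"
proof -
  have "polyhedral_convex_set {u + v | u v. u \<in> epi f\<^sub>1 \<and> v \<in> epi f\<^sub>2}"
    using assms(3,4) polyhedral_convex_set_plus_generalized
    unfolding polyhedral_convex_function_def generalized_polyhedral_convex_function_def by blast
  then show ?thesis
    using epi_infimal_convolution[OF assms(1,2)] by (simp add: polyhedral_convex_function_def)
qed

end
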